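(* The value of the factorization bound is independent of the particular factorization: if $C=F_1F_1^\top=F_2F_2^\top$ with $F_1\in\mathbb{R}^{n\times k_1}$, $F_2\in\mathbb{R}^{n\times k_2}$, $r\le k_1\le n$ and $r\le k_2\le n$, then $$z_{\mathrm{DFact}}(C,s,A,b;F_1)=z_{\mathrm{DFact}}(C,s,A,b;F_2).$$
   Context: Let $n>1$, $0<s<n$ be integers, let $C$ be a real symmetric positive semidefinite $n\times n$ matrix of rank $r\ge s$, and let $A\in\mathbb{R}^{m\times n}$, $b\in\mathbb{R}^m$. For a symmetric matrix $M$, $\lambda_\ell(M)$ is its $\ell$-th greatest eigenvalue (with multiplicity); $\operatorname{diag}(M)$ is the vector of diagonal entries of $M$; $\mathbf{e}$ is the all-ones vector; vector inequalities are componentwise. For a factorization $C=FF^\top$ with $F\in\mathbb{R}^{n\times k}$, $r\le k\le n$, the factorization bound $z_{\mathrm{DFact}}(C,s,A,b;F)$ is the optimal value (infimum, in the extended reals) of: minimize $$-\sum_{\ell=k-s+1}^{k}\log\lambda_\ell(\Theta)+\nu^\top\mathbf{e}+\pi^\top b+\tau s-s$$ over symmetric $\Theta\in\mathbb{R}^{k\times k}$, $\upsilon,\nu\in\mathbb{R}^n$, $\pi\in\mathbb{R}^m$, $\tau\in\mathbb{R}$, subject to $$\operatorname{diag}(F\Theta F^\top)+\upsilon-\nu-A^\top\pi-\tau\mathbf{e}=0,\qquad \Theta\succ0,\ \upsilon\ge0,\ \nu\ge0,\ \pi\ge0 .$$ *)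

theory Defs
  imports
    "HOL-Library.Extended_Real"
    "Jordan_Normal_Form.Char_Poly"
    "Jordan_Normal_Form.DL_Rank"
begin

definition symmetric_mat :: "real mat \<Rightarrow> bool" where
  "symmetric_mat M \<longleftrightarrow> transpose_mat M = M"

definition psd_mat :: "real mat \<Rightarrow> bool" where
  "psd_mat M \<longleftrightarrow> symmetric_mat M \<and>
     (\<forall>x \<in> carrier_vec (dim_row M). 0 \<le> x \<bullet> (M *\<^sub>v x))"

definition pd_mat :: "real mat \<Rightarrow> bool" where
  "pd_mat M \<longleftrightarrow> symmetric_mat M \<and>
     (\<forall>x \<in> carrier_vec (dim_row M). x \<noteq> 0\<^sub>v (dim_row M) \<longrightarrow> 0 < x \<bullet> (M *\<^sub>v x))"

text \<open>Eigenvalues are the roots of the characteristic polynomial with multiplicity, listed in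
  decreasing order. A symmetric \<open>k \<times> k\<close> matrix has exactly \<open>k\<close> of them, and the index \<open>l\<close> is
  1-based, so that \<open>eigval_desc M l\<close> is meaningful for symmetric \<open>M\<close> and \<open>1 \<le> l \<le> k\<close>.\<close>

definition eigval_desc :: "real mat \<Rightarrow> nat \<Rightarrow> real" where
  "eigval_desc M l = rev (sorted_list_of_multiset (proots (char_poly M))) ! (l - 1)"

definition diag_vec :: "real mat \<Rightarrow> real vec" where
  "diag_vec M = vec_of_list (diag_mat M)"

definition ones_vec :: "nat \<Rightarrow> real vec" where
  "ones_vec n = vec n (\<lambda>_. 1)"

text \<open>The order \<open>\<le>\<close> on vectors is componentwise. All dimensions are read off the matrices:
  \<open>n = dim_row C\<close>, \<open>m = dim_row A\<close> and \<open>k = dim_col F\<close>.\<close>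

definition dfact_feasible ::
  "real mat \<Rightarrow> real mat \<Rightarrow> real mat \<Rightarrow>
   real mat \<Rightarrow> real vec \<Rightarrow> real vec \<Rightarrow> real vec \<Rightarrow> real \<Rightarrow> bool" where
  "dfact_feasible C A F \<Theta> \<upsilon> \<nu> \<pi> \<tau> \<longleftrightarrow>
     (let n = dim_row C; m = dim_row A; k = dim_col F in
        \<Theta> \<in> carrier_mat k k \<and> \<upsilon> \<in> carrier_vec n \<and> \<nu> \<in> carrier_vec n \<and> \<pi> \<in> carrier_vec m \<and>
        diag_vec (F * \<Theta> * transpose_mat F) + \<upsilon> - \<nu> - transpose_mat A *\<^sub>v \<pi> - \<tau> \<cdot>\<^sub>v ones_vec n = 0\<^sub>v n \<and>
        pd_mat \<Theta> \<and> 0\<^sub>v n \<le> \<upsilon> \<and> 0\<^sub>v n \<le> \<nu> \<and> 0\<^sub>v m \<le> \<pi>)"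

definition dfact_objective ::
  "real mat \<Rightarrow> nat \<Rightarrow> real vec \<Rightarrow> real mat \<Rightarrow>
   real mat \<Rightarrow> real vec \<Rightarrow> real vec \<Rightarrow> real \<Rightarrow> real" where
  "dfact_objective C s b F \<Theta> \<nu> \<pi> \<tau> =
     (let n = dim_row C; k = dim_col F in
        - (\<Sum>l = k - s + 1..k. ln (eigval_desc \<Theta> l)) + \<nu> \<bullet> ones_vec n + \<pi> \<bullet> b + \<tau> * real s - real s)"

text \<open>\<open>F\<close> is meant to be a factor of \<open>C\<close>, that is \<open>C = F * transpose_mat F\<close>.\<close>

definition z_DFact :: "real mat \<Rightarrow> nat \<Rightarrow> real mat \<Rightarrow> real vec \<Rightarrow> real mat \<Rightarrow> ereal" where
  "z_DFact C s A b F =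
     Inf {ereal (dfact_objective C s b F \<Theta> \<nu> \<pi> \<tau>) | \<Theta> \<upsilon> \<nu> \<pi> \<tau>. dfact_feasible C A F \<Theta> \<upsilon> \<nu> \<pi> \<tau>}"

end

theory Submission
  imports Defs "Jordan_Normal_Form.Schur_Decomposition"
begin

text \<open>If \<open>F\<^sub>1 F\<^sub>1\<^sup>T = F\<^sub>2 F\<^sub>2\<^sup>T\<close>, then \<open>F\<^sub>1 = F\<^sub>2 W\<^sup>T\<close> for a contraction \<open>W\<close>. A feasible point with matrix
  \<open>\<Theta>\<close> for \<open>F\<^sub>1\<close> is turned into one for \<open>F\<^sub>2\<close>, with the other variables unchanged, by taking
  \<open>\<Theta>' = W\<^sup>T \<Theta> W + t (1 - W\<^sup>T W)\<close>: the summand with factor \<open>t\<close> is annihilated by \<open>F\<^sub>2\<close> on both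
  sides, because \<open>F\<^sub>2 W\<^sup>T W F\<^sub>2\<^sup>T = F\<^sub>1 F\<^sub>1\<^sup>T\<close>. When \<open>t\<close> is the \<open>s\<close>-th smallest eigenvalue of \<open>\<Theta>\<close>, the
  \<open>s\<close> smallest eigenvalues of \<open>\<Theta>'\<close> are bounded below by those of \<open>\<Theta>\<close>, so the objective does not
  increase. Exchanging the roles of \<open>F\<^sub>1\<close> and \<open>F\<^sub>2\<close> gives equality.\<close>

subsection \<open>Spectral theorem for real symmetric matrices\<close>

text \<open>Gram-Schmidt applied to a basis completed from \<open>v\<close> keeps \<open>v\<close>
  as its first vector, and normalising then gives orthonormal columns. The scalar \<open>c\<close>
  absorbs the normalisation, since only the direction of the first column matters for
  deflation.\<close>

lemma orthonormal_extension:
  fixes v :: "real vec"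
  assumes v: "v \<in> carrier_vec n" and v0: "v \<noteq> 0\<^sub>v n"
  obtains W c where "W \<in> carrier_mat n n" "transpose_mat W * W = 1\<^sub>m n" "col W 0 = c \<cdot>\<^sub>v v"
proof -
  interpret cof_vec_space n "TYPE(real)" .
  define b where "b = basis_completion v"
  from basis_completion[OF v v0, folded b_def]
  have dist: "distinct b" and indep: "\<not> lin_dep (set b)" and b: "set b \<subseteq> carrier_vec n"
    and hdb: "hd b = v" and len: "length b = n" by auto
  have n: "n > 0" using v v0 by (cases n) auto
  obtain vs where bv: "b = v # vs" using hdb len n by (cases b) auto
  define ws where "ws = gram_schmidt n b"
  have ws: "set ws \<subseteq> carrier_vec n" and orth: "corthogonal ws" and lenw: "length ws = n"
    using gram_schmidt_result[OF b dist indep refl] len by (auto simp: ws_def)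
  have "hd ws = v" using gram_schmidt_hd[OF v, of vs] by (simp add: ws_def bv)
  then have ws0: "ws ! 0 = v" using lenw n by (metis hd_conv_nth length_0_conv less_numeral_extra(3))
  define u where "u i = (1 / sqrt (ws ! i \<bullet> ws ! i)) \<cdot>\<^sub>v (ws ! i)" for i
  have wsi: "ws ! i \<in> carrier_vec n" if "i < n" for i using ws lenw that by auto
  have ui: "u i \<in> carrier_vec n" if "i < n" for i using wsi[OF that] by (simp add: u_def)
  have dot: "ws ! i \<bullet> ws ! j = 0 \<longleftrightarrow> i \<noteq> j" if "i < n" "j < n" for i j
    using corthogonalD[OF orth, of i j] that lenw by (simp add: conjugate_vec_def vec_eq_iff)
  have uu: "u i \<bullet> u j = (if i = j then 1 else 0)" if "i < n" "j < n" for i j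
  proof -
    have "ws ! i \<bullet> ws ! i \<ge> 0" by (simp add: scalar_prod_def sum_nonneg)
    then show ?thesis
      using dot[OF that] dot[OF that(1) that(1)] wsi[OF that(1)] wsi[OF that(2)]
      by (auto simp: u_def)
  qed
  define W where "W = mat_of_cols n (map u [0..<n])"
  have W: "W \<in> carrier_mat n n" by (simp add: W_def mat_of_cols_def)
  have col: "col W i = u i" if "i < n" for i using ui[OF that] that by (simp add: W_def)
  have "transpose_mat W * W = 1\<^sub>m n"
    using W by (intro eq_matI) (auto simp: col uu)
  moreover have "col W 0 = (1 / sqrt (v \<bullet> v)) \<cdot>\<^sub>v v" using col[OF n] by (simp add: u_def ws0)
  ultimately show thesis using that W by blast
qed

text \<open>Deflation, by induction on the list of roots: in an orthonormal basis that starts with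
  an eigenvector for \<open>e\<close>, the matrix splits into \<open>e\<close> and a smaller
  symmetric block, whose characteristic polynomial has the remaining roots. The list may come in any
  order, so the sorted one can be chosen later.\<close>

lemma spectral_decomposition_aux:
  fixes A :: "real mat"
  assumes "A \<in> carrier_mat n n" "symmetric_mat A" "char_poly A = (\<Prod>e\<leftarrow>es. [:- e, 1:])"
  shows "\<exists>P \<in> carrier_mat n n. transpose_mat P * P = 1\<^sub>m n \<and>
           transpose_mat P * A * P = mat_diag n ((!) es)"
  using assms
proof (induction es arbitrary: n A)
  case Nil
  then have "n = 0" using degree_monic_char_poly[of A n] by auto
  then show ?case by (intro bexI[of _ "1\<^sub>m 0"]) (auto intro!: eq_matI simp: mat_diag_def)
next
  case (Cons e es n A)
  note A = Cons.prems(1)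
  have deg: "degree (\<Prod>e\<leftarrow>e # es. [:- e, 1:]) = length (e # es)"
    using degree_linear_factors[of uminus "e # es"] .
  obtain n1 where n: "n = Suc n1" 
    using degree_monic_char_poly[OF A] deg Cons.prems(3) by auto
  have "eigenvalue A e" using Cons.prems(3) by (simp add: eigenvalue_root_char_poly[OF A])
  then obtain v where v: "v \<in> carrier_vec n" "v \<noteq> 0\<^sub>v n" and ev: "A *\<^sub>v v = e \<cdot>\<^sub>v v"
    using A by (auto simp: eigenvalue_def eigenvector_def)
  obtain W c where W: "W \<in> carrier_mat n n" and WW: "transpose_mat W * W = 1\<^sub>m n"
    and W0: "col W 0 = c \<cdot>\<^sub>v v"
    using orthonormal_extension[OF v] .
  define A' where "A' = transpose_mat W * A * W"
  have A': "A' \<in> carrier_mat n n" using A W by (simp add: A'_def)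
  have symA: "transpose_mat A = A" using Cons.prems(2) by (simp add: symmetric_mat_def)
  have symA': "transpose_mat A' = A'"
    using A W by (simp add: A'_def transpose_mult[of _ n n _ n] symA assoc_mult_mat[of _ n n _ n _ n])
  have "A *\<^sub>v col W 0 = e \<cdot>\<^sub>v col W 0"
    using A v ev by (simp add: W0 mult_mat_vec[of _ n n] smult_smult_assoc mult.commute)
  moreover have "A' = transpose_mat W * (A * W)" using A W by (simp add: A'_def assoc_mult_mat[of _ n n _ n _ n])
  then have "col A' 0 = transpose_mat W *\<^sub>v (A *\<^sub>v col W 0)"
    using A W n col_mult2[of "transpose_mat W" n n "A * W" n 0] col_mult2[of A n n W n 0] by simp
  ultimately have "col A' 0 = transpose_mat W *\<^sub>v (e \<cdot>\<^sub>v col W 0)" by simp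
  also have "\<dots> = e \<cdot>\<^sub>v col (transpose_mat W * W) 0"
    using W n mult_mat_vec[of "transpose_mat W" n n "col W 0" e] col_carrier_vec[of 0 n W n] col_mult2[of "transpose_mat W" n n W n 0]
    by simp
  finally have col0: "col A' 0 = e \<cdot>\<^sub>v unit_vec n 0" using n by (simp add: WW)
  have A'i0: "A' $$ (i, 0) = (if i = 0 then e else 0)" if "i < n" for i
    using arg_cong[OF col0, of "\<lambda>x. x $ i"] that A' n by auto
  \<comment> \<open>Symmetry carries the zeros of the first column over to the first row, so
    \<open>A'\<close> is block diagonal.\<close>
  have A'0i: "A' $$ (0, i) = (if i = 0 then e else 0)" if "i < n" for i
    using arg_cong[OF symA', of "\<lambda>M. M $$ (i, 0)"] A'i0[OF that] that A' n by auto
  define A3 where "A3 = Matrix.mat n1 n1 (\<lambda>(i, j). A' $$ (Suc i, Suc j))"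
  have A3: "A3 \<in> carrier_mat n1 n1" by (simp add: A3_def)
  define E where "E = (Matrix.mat 1 1 (\<lambda>_. e) :: real mat)"
  have E: "E \<in> carrier_mat 1 1" by (simp add: E_def)
  have block: "A' = four_block_mat E (0\<^sub>m 1 n1) (0\<^sub>m n1 1) A3"
    using A' n by (intro eq_matI) (auto simp: A3_def E_def A'i0 A'0i)
  \<comment> \<open>Similarity preserves the characteristic polynomial, so the factor for
    \<open>e\<close> can be cancelled to leave that of \<open>A3\<close>.\<close>
  have sim: "similar_mat A' A"
    unfolding similar_mat_def similar_mat_wit_def Let_def
    using A A' W WW mat_mult_left_right_inverse[OF _ W WW] 
    by (intro exI[of _ "transpose_mat W"] exI[of _ W]) (auto simp: A'_def)
  have "char_poly A = char_poly E * char_poly A3"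
    using char_poly_similar[OF sim] char_poly_four_block_zeros_col[OF E _ A3, of "0\<^sub>m 1 n1"]
    by (simp add: block)
  moreover have "char_poly E = [:- e, 1:]"
    by (simp add: E_def char_poly_defs det_def sign_def)
  ultimately have "[:- e, 1:] * char_poly A3 = [:- e, 1:] * (\<Prod>e\<leftarrow>es. [:- e, 1:])"
    using Cons.prems(3) by simp
  then have cp: "char_poly A3 = (\<Prod>e\<leftarrow>es. [:- e, 1:])"
    by (metis mult_cancel_left pCons_eq_0_iff zero_neq_one)
  have "symmetric_mat A3"
    unfolding symmetric_mat_def
  proof (rule eq_matI)
    fix i j assume "i < dim_row A3" "j < dim_col A3"
    then show "transpose_mat A3 $$ (i, j) = A3 $$ (i, j)"
      using A' n arg_cong[OF symA', of "\<lambda>M. M $$ (Suc i, Suc j)"] by (simp add: A3_def)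
  qed (auto simp: A3_def)
  from Cons.IH[OF A3 this cp] obtain P where P: "P \<in> carrier_mat n1 n1"
    and PP: "transpose_mat P * P = 1\<^sub>m n1" and PAP: "transpose_mat P * A3 * P = mat_diag n1 ((!) es)"
    by blast
  \<comment> \<open>\<open>Q\<close> fixes the eigenvector already split off and diagonalises the
    remaining block, so \<open>W * Q\<close> diagonalises \<open>A\<close>.\<close>
  define Q where "Q = four_block_mat (1\<^sub>m 1) (0\<^sub>m 1 n1) (0\<^sub>m n1 1) P"
  have Q: "Q \<in> carrier_mat n n" using P n four_block_carrier_mat[of "1\<^sub>m 1" 1 1 P n1 n1] by (simp add: Q_def)
  have QT: "transpose_mat Q = four_block_mat (1\<^sub>m 1) (0\<^sub>m 1 n1) (0\<^sub>m n1 1) (transpose_mat P)"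
    using P by (simp add: Q_def transpose_four_block_mat[of _ 1 1 _ n1 _ n1])
  have QQ: "transpose_mat Q * Q = 1\<^sub>m n"
    unfolding QT unfolding Q_def using P n
    by (subst mult_four_block_mat[of _ 1 1 _ n1 _ n1 _ _ 1 _ n1]) (auto simp: PP)
  have "transpose_mat Q * A' = four_block_mat E (0\<^sub>m 1 n1) (0\<^sub>m n1 1) (transpose_mat P * A3)"
    unfolding QT block using P E A3
    by (subst mult_four_block_mat[of _ 1 1 _ n1 _ n1 _ _ 1 _ n1]) auto
  then have "transpose_mat Q * A' * Q = four_block_mat E (0\<^sub>m 1 n1) (0\<^sub>m n1 1) (mat_diag n1 ((!) es))"
    unfolding Q_def using P E A3
    by (simp, subst mult_four_block_mat[of _ 1 1 _ n1 _ n1 _ _ 1 _ n1]) (auto simp: PAP)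
  also have "\<dots> = mat_diag n ((!) (e # es))"
    using n by (intro eq_matI) (auto simp: E_def mat_diag_def nth_Cons')
  finally have D: "transpose_mat Q * A' * Q = mat_diag n ((!) (e # es))" .
  show ?case
  proof (intro bexI conjI)
    show "W * Q \<in> carrier_mat n n" using W Q by simp
    have "transpose_mat (W * Q) * (W * Q) = transpose_mat Q * (transpose_mat W * W) * Q"
      using W Q by (simp add: transpose_mult[of _ n n _ n] assoc_mult_mat[of _ n n _ n _ n])
    then show "transpose_mat (W * Q) * (W * Q) = 1\<^sub>m n" using Q by (simp add: WW QQ)
    have "transpose_mat (W * Q) * A * (W * Q) = transpose_mat Q * A' * Q"
      using A W Q by (simp add: A'_def transpose_mult[of _ n n _ n] assoc_mult_mat[of _ n n _ n _ n])
    then show "transpose_mat (W * Q) * A * (W * Q) = mat_diag n ((!) (e # es))" by (simp add: D)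
  qed
qed

text \<open>For a complex eigenvector \<open>v\<close>, moving the real symmetric matrix from one
  side of the nonzero product \<open>v \<bullet> conjugate v\<close> to the other shows that
  multiplying it by \<open>a\<close> or by \<open>cnj a\<close> gives the same number.\<close>

lemma eigenvalue_symmetric_real:
  fixes A :: "real mat" and a :: complex
  assumes A: "A \<in> carrier_mat n n" and sym: "symmetric_mat A"
    and ev: "eigenvalue (map_mat complex_of_real A) a"
  shows "a \<in> \<real>"
proof -
  let ?A = "map_mat complex_of_real A"
  have cA: "?A \<in> carrier_mat n n" using A by simp
  obtain v where v: "v \<in> carrier_vec n" "v \<noteq> 0\<^sub>v n" and av: "?A *\<^sub>v v = a \<cdot>\<^sub>v v"
    using ev A by (auto simp: eigenvalue_def eigenvector_def)
  have cv: "conjugate v \<in> carrier_vec n" using v by simp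
  have symA: "transpose_mat ?A = ?A"
    using sym unfolding symmetric_mat_def by (metis map_mat_transpose)
  have "?A *\<^sub>v conjugate v = conjugate (?A *\<^sub>v v)"
    using A v by (intro eq_vecI) (auto simp: scalar_prod_def)
  also have "\<dots> = cnj a \<cdot>\<^sub>v conjugate v"
    using v by (simp add: av conjugate_smult_vec)
  finally have 1: "?A *\<^sub>v conjugate v = cnj a \<cdot>\<^sub>v conjugate v" .
  have "a * (v \<bullet> conjugate v) = (?A *\<^sub>v v) \<bullet> conjugate v"
    using v cv by (simp add: av)
  also have "\<dots> = v \<bullet> (?A *\<^sub>v conjugate v)"
    using transpose_vec_mult_scalar[OF cA cv v(1)] by (simp add: symA)
  also have "\<dots> = cnj a * (v \<bullet> conjugate v)"
    using v cv by (simp add: 1)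
  finally have "a * (v \<bullet> conjugate v) = cnj a * (v \<bullet> conjugate v)" .
  moreover have "v \<bullet> conjugate v \<noteq> 0" using v conjugate_square_eq_0_vec by blast
  ultimately have "cnj a = a" by simp
  then show ?thesis by (simp add: Reals_cnj_iff)
qed

text \<open>The polynomial splits over the complex numbers and all its roots are real, so the
  factorization descends to the reals because the embedding of coefficients is injective.\<close>

lemma char_poly_symmetric_splits:
  fixes A :: "real mat"
  assumes A: "A \<in> carrier_mat n n" and sym: "symmetric_mat A"
  shows "\<exists>es. char_poly A = (\<Prod>e\<leftarrow>es. [:- e, 1:])"
proof -
  let ?A = "map_mat complex_of_real A"
  have cA: "?A \<in> carrier_mat n n" using A by simp
  obtain as where as: "char_poly ?A = (\<Prod>a\<leftarrow>as. [:- a, 1:])"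
    using char_poly_factorized[OF cA] by blast
  have "a \<in> \<real>" if "a \<in> set as" for a
    using eigenvalue_symmetric_real[OF A sym] linear_poly_root[OF that] 
    by (simp add: eigenvalue_root_char_poly[OF cA] as)
  then have re: "map (\<lambda>a. complex_of_real (Re a)) as = as"
    by (intro map_idI) (simp add: complex_is_Real_iff complex_eq_iff)
  have "map_poly complex_of_real (char_poly A) = (\<Prod>a\<leftarrow>as. [:- a, 1:])"
    using of_real_hom.char_poly_hom[OF A] as by metis
  also have "\<dots> = (\<Prod>a\<leftarrow>map (\<lambda>a. complex_of_real (Re a)) as. [:- a, 1:])"
    by (simp only: re)
  also have "\<dots> = map_poly complex_of_real (\<Prod>e\<leftarrow>map Re as. [:- e, 1:])"
  proof (induction as)
    case (Cons a as)
    have "map_poly complex_of_real ([:- Re a, 1:] * p) = [:- complex_of_real (Re a), 1:] * map_poly complex_of_real p" for p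
      by (intro poly_eqI) (auto simp: coeff_map_poly coeff_pCons split: nat.split)
    then show ?case using Cons by (simp del: mult_pCons_left)
  qed simp
  finally have "char_poly A = (\<Prod>e\<leftarrow>map Re as. [:- e, 1:])"
    by (simp add: poly_eq_iff coeff_map_poly)
  then show ?thesis ..
qed

text \<open>The diagonal is pinned to the increasing list of eigenvalues, the reversal of the list
  behind \<open>eigval_desc\<close>, so that position 0 holds the smallest.\<close>

lemma spectral_decomposition:
  fixes A :: "real mat"
  assumes A: "A \<in> carrier_mat n n" and sym: "symmetric_mat A"
    and es_def: "es = sorted_list_of_multiset (proots (char_poly A))"
  obtains P where "P \<in> carrier_mat n n" "transpose_mat P * P = 1\<^sub>m n"
    "transpose_mat P * A * P = mat_diag n ((!) es)" "length es = n"
proof -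
  obtain fs where fs: "char_poly A = (\<Prod>e\<leftarrow>fs. [:- e, 1:])"
    using char_poly_symmetric_splits[OF A sym] by blast
  \<comment> \<open>Hence \<open>es\<close> is a rearrangement of \<open>fs\<close> and yields the
    same product of linear factors.\<close>
  have "proots (\<Prod>e\<leftarrow>fs. [:- e, 1:]) = mset fs"
  proof (induction fs)
    case (Cons f fs)
    have "(\<Prod>e\<leftarrow>fs. [:- e, 1:]) \<noteq> 0" by (auto simp: prod_list_zero_iff)
    then show ?case using Cons by (simp add: proots_mult del: mult_pCons_left)
  qed simp
  then have ms: "mset es = mset fs" by (simp add: es_def fs)
  have cp: "char_poly A = (\<Prod>e\<leftarrow>es. [:- e, 1:])"
    using ms fs by (metis mset_map prod_mset_prod_list)
  have "length es = n"
    using degree_monic_char_poly[OF A] degree_linear_factors[of uminus es] cp by simp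
  then show thesis using spectral_decomposition_aux[OF A sym cp] that by blast
qed

lemma orthogonal_norm:
  fixes P :: "real mat"
  assumes P: "P \<in> carrier_mat n n" "transpose_mat P * P = 1\<^sub>m n" and x: "x \<in> carrier_vec n"
  shows "(P *\<^sub>v x) \<bullet> (P *\<^sub>v x) = x \<bullet> x"
proof -
  have "(P *\<^sub>v x) \<bullet> (P *\<^sub>v x) = (transpose_mat P *\<^sub>v (P *\<^sub>v x)) \<bullet> x"
    using P x by (subst transpose_vec_mult_scalar[of _ n n]) auto
  also have "transpose_mat P *\<^sub>v (P *\<^sub>v x) = x"
    using P x assoc_mult_mat_vec[of "transpose_mat P" n n P n x] by simp
  finally show ?thesis .
qed

text \<open>The entries of \<open>c\<close> are coordinates with respect to the columns of
  \<open>P\<close>; an eigenbasis turns the quadratic form into a weighted sum of squares.\<close>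

lemma quadratic_form_diagonalised:
  fixes A P :: "real mat"
  assumes A: "A \<in> carrier_mat n n" and P: "P \<in> carrier_mat n n"
    and D: "transpose_mat P * A * P = mat_diag n f" and c: "c \<in> carrier_vec n"
  shows "(P *\<^sub>v c) \<bullet> (A *\<^sub>v (P *\<^sub>v c)) = (\<Sum>i<n. f i * (c $ i)\<^sup>2)"
proof -
  have "(P *\<^sub>v c) \<bullet> (A *\<^sub>v (P *\<^sub>v c)) = c \<bullet> (transpose_mat P *\<^sub>v (A *\<^sub>v (P *\<^sub>v c)))"
    using transpose_vec_mult_scalar[of "transpose_mat P" n n "A *\<^sub>v (P *\<^sub>v c)" c] A P c by simp
  also have "transpose_mat P *\<^sub>v (A *\<^sub>v (P *\<^sub>v c)) = mat_diag n f *\<^sub>v c"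
    using A P c unfolding D[symmetric]
    by (simp add: assoc_mult_mat_vec[of _ n n _ n] assoc_mult_mat[of _ n n _ n _ n])
  also have "\<dots> = vec n (\<lambda>i. f i * c $ i)"
    using c by (intro eq_vecI)
      (auto simp: mat_diag_def scalar_prod_def if_distrib[of "\<lambda>x. x * _"] sum.delta' cong: if_cong)
  also have "c \<bullet> \<dots> = (\<Sum>i<n. f i * (c $ i)\<^sup>2)"
    using c by (simp add: scalar_prod_def power2_eq_square algebra_simps atLeast0LessThan)
  finally show ?thesis .
qed

subsection \<open>Eigenvalue comparison\<close>

text \<open>Padding the \<open>j\<close> equations in \<open>j + 1\<close> unknowns with a zero row
  gives a singular square matrix, whose kernel supplies the solution.\<close>

lemma underdetermined_system:
  fixes a :: "nat \<Rightarrow> nat \<Rightarrow> real"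
  obtains c where "\<And>i. i < j \<Longrightarrow> (\<Sum>l\<le>j. a i l * c l) = 0" "\<exists>l\<le>j. c l \<noteq> 0"
proof -
  define M where "M = Matrix.mat (Suc j) (Suc j) (\<lambda>(i, l). if i < j then a i l else 0)"
  have M: "M \<in> carrier_mat (Suc j) (Suc j)" by (simp add: M_def)
  \<comment> \<open>The transpose sends the last unit vector to the last row of \<open>M\<close>,
    which is the padding.\<close>
  have "transpose_mat M *\<^sub>v unit_vec (Suc j) j = 0\<^sub>v (Suc j)"
    using M by (intro eq_vecI) (auto simp: M_def)
  moreover have "unit_vec (Suc j) j \<noteq> (0\<^sub>v (Suc j) :: real vec)" by simp
  ultimately have "det (transpose_mat M) = 0"
    using M by (subst det_0_iff_vec_prod_zero[of _ "Suc j"]) (auto intro!: exI[of _ "unit_vec (Suc j) j"])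
  then have "det M = 0" using det_transpose[OF M] by simp
  then obtain v where v: "v \<in> carrier_vec (Suc j)" "v \<noteq> 0\<^sub>v (Suc j)" and Mv: "M *\<^sub>v v = 0\<^sub>v (Suc j)"
    using det_0_iff_vec_prod_zero[OF M] by blast
  show thesis
  proof (rule that[of "\<lambda>l. v $ l"])
    fix i assume i: "i < j"
    have "(M *\<^sub>v v) $ i = 0" using i by (simp add: Mv)
    moreover have "(M *\<^sub>v v) $ i = (\<Sum>l\<in>{0..<Suc j}. a i l * v $ l)"
      using i v(1) by (simp add: M_def scalar_prod_def)
    ultimately show "(\<Sum>l\<le>j. a i l * v $ l) = 0"
      by (simp only: atLeast0LessThan lessThan_Suc_atMost)
  next
    show "\<exists>l\<le>j. v $ l \<noteq> 0"
    proof (rule ccontr)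
      assume "\<not> ?thesis"
      then have "v = 0\<^sub>v (Suc j)" using v(1) by (intro eq_vecI) auto
      then show False using v(2) by simp
    qed
  qed
qed

lemma scalar_prod_self_sum:
  fixes x :: "real vec"
  shows "x \<in> carrier_vec n \<Longrightarrow> x \<bullet> x = (\<Sum>i<n. (x $ i)\<^sup>2)"
  by (simp add: scalar_prod_def power2_eq_square atLeast0LessThan)

text \<open>The Courant--Fischer argument: some nonzero vector lies in the span of the lowest \<open>j + 1\<close>
  eigenvectors of \<open>M\<close> while its image under \<open>W\<close> is orthogonal to the lowest \<open>j\<close> eigenvectors
  of \<open>N\<close>.\<close>

lemma eigenvalue_comparison:
  fixes M N W :: "real mat"
  assumes M: "M \<in> carrier_mat k k" "symmetric_mat M"
    and N: "N \<in> carrier_mat l l" "symmetric_mat N"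
    and W: "W \<in> carrier_mat l k"
    and fs: "fs = sorted_list_of_multiset (proots (char_poly M))"
    and es: "es = sorted_list_of_multiset (proots (char_poly N))"
    and contr: "\<And>x. x \<in> carrier_vec k \<Longrightarrow> (W *\<^sub>v x) \<bullet> (W *\<^sub>v x) \<le> x \<bullet> x"
    and form: "\<And>x. x \<in> carrier_vec k \<Longrightarrow>
      (W *\<^sub>v x) \<bullet> (N *\<^sub>v (W *\<^sub>v x)) + t * (x \<bullet> x - (W *\<^sub>v x) \<bullet> (W *\<^sub>v x)) \<le> x \<bullet> (M *\<^sub>v x)"
    and j: "j < k" "j < l" and t: "es ! j \<le> t"
  shows "es ! j \<le> fs ! j"
proof -
  obtain P where P: "P \<in> carrier_mat k k" "transpose_mat P * P = 1\<^sub>m k"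
    and DM: "transpose_mat P * M * P = mat_diag k ((!) fs)" and lf: "length fs = k"
    using spectral_decomposition[OF M fs] .
  obtain Q where Q: "Q \<in> carrier_mat l l" "transpose_mat Q * Q = 1\<^sub>m l"
    and DN: "transpose_mat Q * N * Q = mat_diag l ((!) es)" and le: "length es = l"
    using spectral_decomposition[OF N es] .
  have QQ: "Q * transpose_mat Q = 1\<^sub>m l"
    using mat_mult_left_right_inverse[of "transpose_mat Q" l Q] Q by simp
  have sf: "sorted fs" and se: "sorted es" by (simp_all add: fs es)
  \<comment> \<open>\<open>T\<close> is \<open>W\<close> written in the eigenbases of
    \<open>M\<close> and \<open>N\<close>; \<open>c\<close> and \<open>d\<close> below are the
    coordinates of \<open>x\<close> and of \<open>W *\<^sub>v x\<close>.\<close>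
  define T where "T = transpose_mat Q * W * P"
  have T: "T \<in> carrier_mat l k" using P Q W by (simp add: T_def)
  obtain c0 where c0: "\<And>i. i < j \<Longrightarrow> (\<Sum>m\<le>j. T $$ (i, m) * c0 m) = 0" "\<exists>m\<le>j. c0 m \<noteq> 0"
    using underdetermined_system[of j "\<lambda>i m. T $$ (i, m)"] by blast
  define c where "c = vec k (\<lambda>i. if i \<le> j then c0 i else 0)"
  have c: "c \<in> carrier_vec k" by (simp add: c_def)
  define d where "d = T *\<^sub>v c"
  have d: "d \<in> carrier_vec l" unfolding d_def using T c by (rule mult_mat_vec_carrier)
  define x where "x = P *\<^sub>v c"
  have x: "x \<in> carrier_vec k" unfolding x_def using P(1) c by (rule mult_mat_vec_carrier)
  have Wx: "W *\<^sub>v x \<in> carrier_vec l" using W x by simp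
  have d0: "d $ i = 0" if "i < j" for i
  proof -
    have "d $ i = (\<Sum>m\<in>{0..<k}. T $$ (i, m) * (if m \<le> j then c0 m else 0))"
      using that j T by (simp add: d_def c_def scalar_prod_def)
    also have "\<dots> = (\<Sum>m\<le>j. T $$ (i, m) * c0 m)"
      using j by (intro sum.mono_neutral_cong_right) auto
    finally show ?thesis using c0(1)[OF that] by simp
  qed
  have "d = transpose_mat Q *\<^sub>v (W *\<^sub>v x)"
    using P Q W c by (simp add: d_def T_def x_def assoc_mult_mat_vec[of _ l k _ k] assoc_mult_mat_vec[of _ l l _ k])
  then have Wx_eq: "W *\<^sub>v x = Q *\<^sub>v d"
    using assoc_mult_mat_vec[of Q l l "transpose_mat Q" l "W *\<^sub>v x"] Q Wx by (simp add: QQ)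
  have nx: "x \<bullet> x = c \<bullet> c" using orthogonal_norm[OF P c] by (simp add: x_def)
  have nW: "(W *\<^sub>v x) \<bullet> (W *\<^sub>v x) = d \<bullet> d" using orthogonal_norm[OF Q d] by (simp add: Wx_eq)
  have "x \<bullet> (M *\<^sub>v x) = (\<Sum>i<k. fs ! i * (c $ i)\<^sup>2)"
    using quadratic_form_diagonalised[OF M(1) P(1) DM c] by (simp add: x_def)
  \<comment> \<open>The coordinates of \<open>c\<close> beyond \<open>j\<close> vanish, so
    \<open>fs ! j\<close> is the largest weight that counts.\<close>
  also have "\<dots> \<le> (\<Sum>i<k. fs ! j * (c $ i)\<^sup>2)"
  proof (rule sum_mono)
    fix i assume "i \<in> {..<k}"
    then show "fs ! i * (c $ i)\<^sup>2 \<le> fs ! j * (c $ i)\<^sup>2"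
      using sorted_nth_mono[OF sf, of i j] j lf by (cases "i \<le> j") (auto simp: c_def intro: mult_right_mono)
  qed
  also have "\<dots> = fs ! j * (c \<bullet> c)" by (simp add: scalar_prod_self_sum[OF c] sum_distrib_left)
  finally have upper: "x \<bullet> (M *\<^sub>v x) \<le> fs ! j * (c \<bullet> c)" .
  have "es ! j * (d \<bullet> d) = (\<Sum>i<l. es ! j * (d $ i)\<^sup>2)"
    by (simp add: scalar_prod_self_sum[OF d] sum_distrib_left)
  \<comment> \<open>Dually, the coordinates of \<open>d\<close> below \<open>j\<close> vanish, so
    \<open>es ! j\<close> is the smallest weight that counts.\<close>
  also have "\<dots> \<le> (\<Sum>i<l. es ! i * (d $ i)\<^sup>2)"
  proof (rule sum_mono)
    fix i assume "i \<in> {..<l}"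
    then show "es ! j * (d $ i)\<^sup>2 \<le> es ! i * (d $ i)\<^sup>2"
      using sorted_nth_mono[OF se, of j i] j le d0[of i] by (cases "i < j") (auto intro: mult_right_mono)
  qed
  also have "\<dots> = (W *\<^sub>v x) \<bullet> (N *\<^sub>v (W *\<^sub>v x))"
    using quadratic_form_diagonalised[OF N(1) Q(1) DN d] by (simp add: Wx_eq)
  finally have lower: "es ! j * (d \<bullet> d) \<le> (W *\<^sub>v x) \<bullet> (N *\<^sub>v (W *\<^sub>v x))" .
  \<comment> \<open>The norm lost under \<open>W\<close> is nonnegative, so its weight
    \<open>t\<close> may be lowered to \<open>es ! j\<close>; the terms in
    \<open>d \<bullet> d\<close> then cancel.\<close>
  have "es ! j * (c \<bullet> c - d \<bullet> d) \<le> t * (c \<bullet> c - d \<bullet> d)"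
    using contr[OF x] t by (intro mult_right_mono) (simp_all add: nx nW)
  then have "es ! j * (c \<bullet> c) \<le> fs ! j * (c \<bullet> c)"
    using form[OF x] upper lower by (simp add: nx nW algebra_simps)
  moreover have "c \<bullet> c > 0"
  proof -
    obtain m where m: "m \<le> j" "c0 m \<noteq> 0" using c0(2) by blast
    show ?thesis unfolding scalar_prod_self_sum[OF c]
      by (rule sum_pos2[of _ m]) (use m j in \<open>auto simp: c_def\<close>)
  qed
  ultimately show ?thesis by simp
qed

text \<open>The quadratic form takes the value \<open>es ! i\<close> at the unit eigenvector
  \<open>P *\<^sub>v unit_vec k i\<close>.\<close>

lemma eigenvalues_pos:
  fixes M :: "real mat"
  assumes M: "M \<in> carrier_mat k k" and pd: "pd_mat M"
    and es: "es = sorted_list_of_multiset (proots (char_poly M))" and i: "i < k"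
  shows "0 < es ! i"
proof -
  have sym: "symmetric_mat M" using pd by (simp add: pd_mat_def)
  obtain P where P: "P \<in> carrier_mat k k" "transpose_mat P * P = 1\<^sub>m k"
    and D: "transpose_mat P * M * P = mat_diag k ((!) es)"
    using spectral_decomposition[OF M sym es] .
  define x where "x = P *\<^sub>v unit_vec k i"
  have x: "x \<in> carrier_vec k" using P by (simp add: x_def)
  have "x \<bullet> x = 1" using orthogonal_norm[OF P, of "unit_vec k i"] i by (simp add: x_def)
  then have "x \<noteq> 0\<^sub>v k" by auto
  then have "0 < x \<bullet> (M *\<^sub>v x)" using pd x M by (auto simp: pd_mat_def)
  also have "x \<bullet> (M *\<^sub>v x) = (\<Sum>l<k. es ! l * (unit_vec k i $ l)\<^sup>2)"
    unfolding x_def by (rule quadratic_form_diagonalised[OF M P(1) D]) simp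
  also have "\<dots> = (\<Sum>l<k. if l = i then es ! i else 0)"
    using i by (intro sum.cong) auto
  also have "\<dots> = es ! i" using i by simp
  finally show ?thesis .
qed

text \<open>The 1-based decreasing index \<open>l\<close> is the 0-based increasing index
  \<open>k - l\<close>, so the last \<open>s\<close> positions become the first
  \<open>s\<close>.\<close>

lemma sum_eigval_desc:
  fixes M :: "real mat"
  assumes M: "M \<in> carrier_mat k k" and sym: "symmetric_mat M" and s: "s \<le> k"
  shows "(\<Sum>l = k - s + 1..k. f (eigval_desc M l))
    = (\<Sum>j<s. f (sorted_list_of_multiset (proots (char_poly M)) ! j))"
proof -
  let ?es = "sorted_list_of_multiset (proots (char_poly M))"
  have len: "length ?es = k" using spectral_decomposition[OF M sym refl] by metis
  have "eigval_desc M l = ?es ! (k - l)" if "1 \<le> l" "l \<le> k" for l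
    using that len by (simp add: eigval_desc_def rev_nth)
  then show ?thesis
    using s by (intro sum.reindex_bij_witness[of _ "\<lambda>j. k - j" "\<lambda>l. k - l"]) auto
qed

subsection \<open>Factoring through a contraction\<close>

text \<open>Inverting the nonzero eigenvalues in an eigenbasis gives the Moore-Penrose inverse, of
  which only these two identities are recorded.\<close>

lemma symmetric_generalised_inverse:
  fixes C :: "real mat"
  assumes C: "C \<in> carrier_mat n n" and sym: "symmetric_mat C"
  obtains G where "G \<in> carrier_mat n n" "transpose_mat G = G" "C * G * C = C"
proof -
  obtain P es where P: "P \<in> carrier_mat n n" and PP: "transpose_mat P * P = 1\<^sub>m n"
    and PCP: "transpose_mat P * C * P = mat_diag n ((!) es)"
    using spectral_decomposition[OF C sym refl] by metis
  define D where "D = mat_diag n ((!) es)"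
  define E where "E = mat_diag n (\<lambda>i. 1 / es ! i)"
    \<comment> \<open>zero eigenvalues are covered by \<open>1 / 0 = 0\<close>\<close>
  have D: "D \<in> carrier_mat n n" and E: "E \<in> carrier_mat n n" by (simp_all add: D_def E_def)
  have ET: "transpose_mat E = E" by (intro eq_matI) (auto simp: E_def mat_diag_def)
  have "(\<lambda>i. es ! i * (1 / es ! i) * es ! i) = (!) es" by (auto simp: fun_eq_iff)
  then have DED: "D * E * D = D" by (simp add: D_def E_def mat_diag_diag)
  have QQ: "P * transpose_mat P = 1\<^sub>m n"
    using mat_mult_left_right_inverse[of "transpose_mat P" n P] P PP by simp
  note assoc = assoc_mult_mat[of _ n n _ n _ n]
  have cancel: "transpose_mat P * (P * X) = X" if "X \<in> carrier_mat n n" for X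
    using that P PP assoc_mult_mat[of "transpose_mat P" n n P n X n] by simp
  have "P * (transpose_mat P * C * P) * transpose_mat P = (P * transpose_mat P) * C * (P * transpose_mat P)"
    using P C by (simp add: assoc)
  then have C_eq: "C = P * D * transpose_mat P" using C by (simp add: QQ PCP D_def)
  define G where "G = P * E * transpose_mat P"
  have G: "G \<in> carrier_mat n n" using P E by (simp add: G_def)
  moreover have "transpose_mat G = G"
    using P E by (simp add: G_def transpose_mult[of _ n n _ n] ET assoc)
  moreover have "C * G * C = P * (D * E * D) * transpose_mat P"
    unfolding C_eq G_def using P D E by (simp add: assoc cancel)
  then have "C * G * C = C" by (simp add: DED C_eq)
  ultimately show thesis using that by blast
qed

text \<open>A case of Douglas' factorization lemma. With a generalised inverse \<open>G\<close> of
  the common product \<open>C\<close>, the witness is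
  \<open>transpose_mat F\<^sub>1 * G * F\<^sub>2\<close>; it is a contraction because
  \<open>transpose_mat W * W\<close> is an orthogonal projection.\<close>

lemma douglas_contraction:
  fixes F\<^sub>1 F\<^sub>2 :: "real mat"
  assumes F1: "F\<^sub>1 \<in> carrier_mat n k\<^sub>1" and F2: "F\<^sub>2 \<in> carrier_mat n k\<^sub>2"
    and eq: "F\<^sub>1 * transpose_mat F\<^sub>1 = F\<^sub>2 * transpose_mat F\<^sub>2"
  obtains W where "W \<in> carrier_mat k\<^sub>1 k\<^sub>2" "F\<^sub>2 * transpose_mat W = F\<^sub>1"
    "\<And>x. x \<in> carrier_vec k\<^sub>2 \<Longrightarrow> (W *\<^sub>v x) \<bullet> (W *\<^sub>v x) \<le> x \<bullet> x"
proof -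
  define C where "C = F\<^sub>1 * transpose_mat F\<^sub>1"
  have C: "C \<in> carrier_mat n n"
    using F1 by (simp add: C_def)
  have C2: "C = F\<^sub>2 * transpose_mat F\<^sub>2" by (simp add: C_def eq)
  have sym: "transpose_mat C = C"
    using F1 by (simp add: C_def transpose_mult[of _ n k\<^sub>1 _ n])
  obtain G where G: "G \<in> carrier_mat n n" and GT: "transpose_mat G = G" and CGC: "C * G * C = C"
    using symmetric_generalised_inverse[OF C] sym by (auto simp: symmetric_mat_def)
  define W where "W = transpose_mat F\<^sub>1 * G * F\<^sub>2"
  have W: "W \<in> carrier_mat k\<^sub>1 k\<^sub>2" using F1 F2 G by (simp add: W_def)
  have WT: "transpose_mat W = transpose_mat F\<^sub>2 * G * F\<^sub>1"
    using F1 F2 G assoc_mult_mat[of "transpose_mat F\<^sub>2" k\<^sub>2 n G n F\<^sub>1 k\<^sub>1]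
    by (simp add: W_def transpose_mult[of _ k\<^sub>1 n _ k\<^sub>2] transpose_mult[of _ k\<^sub>1 n _ n]
        transpose_mult[of _ n n _ k\<^sub>2] GT)
  \<comment> \<open>The identity \<open>CGC\<close> directly gives only
    \<open>Z * transpose_mat F\<^sub>1 = 0\<^sub>m n n\<close>. Since \<open>transpose_mat Z\<close>
    has \<open>transpose_mat F\<^sub>1\<close> as a left factor, \<open>Z * transpose_mat Z\<close>
    vanishes too, and its diagonal holds the squared norms of the rows of \<open>Z\<close>.\<close>
  define Z where "Z = C * G * F\<^sub>1 - F\<^sub>1"
  have CG: "C * G \<in> carrier_mat n n" using C G by simp
  have CGF: "C * G * F\<^sub>1 \<in> carrier_mat n k\<^sub>1" using C G F1 by simp
  have Z: "Z \<in> carrier_mat n k\<^sub>1" using F1 by (simp add: Z_def minus_carrier_mat)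
  have "transpose_mat Z = transpose_mat F\<^sub>1 * (G * C) - transpose_mat F\<^sub>1"
    using F1 C G CG CGF by (simp add: Z_def transpose_minus[of _ n k\<^sub>1] transpose_mult[of _ n n _ k\<^sub>1]
        transpose_mult[of _ n n _ n] GT sym)
  moreover have "Z * (transpose_mat F\<^sub>1 * (G * C) - transpose_mat F\<^sub>1)
      = Z * (transpose_mat F\<^sub>1 * (G * C)) - Z * transpose_mat F\<^sub>1"
    using Z F1 C G by (intro mult_minus_distrib_mat) auto
  moreover have ZF: "Z * transpose_mat F\<^sub>1 = 0\<^sub>m n n"
  proof -
    have "Z * transpose_mat F\<^sub>1 = C * G * F\<^sub>1 * transpose_mat F\<^sub>1 - F\<^sub>1 * transpose_mat F\<^sub>1"
      unfolding Z_def using F1 CGF by (intro minus_mult_distrib_mat) auto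
    also have "C * G * F\<^sub>1 * transpose_mat F\<^sub>1 = C * G * C"
      using F1 CG assoc_mult_mat[OF CG F1, of "transpose_mat F\<^sub>1" n] by (simp add: C_def)
    finally show ?thesis using C by (simp add: CGC C_def[symmetric])
  qed
  moreover have "Z * (transpose_mat F\<^sub>1 * (G * C)) = 0\<^sub>m n n"
    using assoc_mult_mat[of Z n k\<^sub>1 "transpose_mat F\<^sub>1" n "G * C" n] Z F1 G C ZF
    by (simp del: assoc_mult_mat)
  ultimately have ZZ: "Z * transpose_mat Z = 0\<^sub>m n n" by simp
  have "Z = 0\<^sub>m n k\<^sub>1"
  proof (rule eq_matI)
    fix i j assume ij: "i < dim_row (0\<^sub>m n k\<^sub>1)" "j < dim_col (0\<^sub>m n k\<^sub>1)"
    have "(\<Sum>l\<in>{0..<k\<^sub>1}. (Z $$ (i, l))\<^sup>2) = (Z * transpose_mat Z) $$ (i, i)"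
      using ij Z by (simp add: scalar_prod_def power2_eq_square)
    also have "\<dots> = 0" using ij by (simp add: ZZ)
    finally show "Z $$ (i, j) = 0\<^sub>m n k\<^sub>1 $$ (i, j)"
      using ij by (simp add: sum_nonneg_eq_0_iff)
  qed (use Z in auto)
  then have "Z $$ (i, j) = 0" if "i < n" "j < k\<^sub>1" for i j using that by simp
  then have entry: "(C * G * F\<^sub>1) $$ (i, j) = F\<^sub>1 $$ (i, j)" if "i < n" "j < k\<^sub>1" for i j
    using that F1 by (simp add: Z_def)
  have CGF1: "C * G * F\<^sub>1 = F\<^sub>1"
    by (rule eq_matI; use entry carrier_matD[OF F1] carrier_matD[OF CGF] in metis)
  have FW: "F\<^sub>2 * transpose_mat W = F\<^sub>1"
  proof -
    have F2T: "transpose_mat F\<^sub>2 \<in> carrier_mat k\<^sub>2 n" using F2 by simp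
    have "F\<^sub>2 * transpose_mat W = F\<^sub>2 * (transpose_mat F\<^sub>2 * G) * F\<^sub>1"
      unfolding WT by (rule assoc_mult_mat[OF F2 mult_carrier_mat[OF F2T G] F1, symmetric])
    also have "F\<^sub>2 * (transpose_mat F\<^sub>2 * G) = C * G"
      unfolding C2 by (rule assoc_mult_mat[OF F2 F2T G, symmetric])
    finally show ?thesis by (simp only: CGF1)
  qed
  define K where "K = transpose_mat W * W"
  have K: "K \<in> carrier_mat k\<^sub>2 k\<^sub>2" using W by (simp add: K_def)
  have KT: "transpose_mat K = K" using W by (simp add: K_def transpose_mult[of _ k\<^sub>2 k\<^sub>1 _ k\<^sub>2])
  define X where "X = transpose_mat F\<^sub>1 * G"
  define Y where "Y = G * F\<^sub>2"
  have X: "X \<in> carrier_mat k\<^sub>1 n" and Y: "Y \<in> carrier_mat n k\<^sub>2"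
    using F1 F2 G by (simp_all add: X_def Y_def)
  have F1T: "transpose_mat F\<^sub>1 \<in> carrier_mat k\<^sub>1 n" and WT': "transpose_mat W \<in> carrier_mat k\<^sub>2 k\<^sub>1"
    using F1 W by simp_all
  have W_Y: "W = transpose_mat F\<^sub>1 * Y"
    unfolding W_def Y_def by (rule assoc_mult_mat[OF F1T G F2])
  \<comment> \<open>The aim is \<open>W * transpose_mat W * W = W\<close>: \<open>W\<close> is a
    partial isometry, which makes the symmetric matrix \<open>K\<close> idempotent.\<close>
  have "W * transpose_mat W = X * F\<^sub>1"
    using assoc_mult_mat[OF X F2 WT'] unfolding FW W_def[folded X_def, symmetric] .
  then have "W * transpose_mat W * W = X * F\<^sub>1 * W" by (simp only:)
  also have "\<dots> = X * F\<^sub>1 * (transpose_mat F\<^sub>1 * Y)" by (subst W_Y) (rule refl)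
  also have "\<dots> = X * (F\<^sub>1 * (transpose_mat F\<^sub>1 * Y))"
    by (rule assoc_mult_mat[OF X F1 mult_carrier_mat[OF F1T Y]])
  also have "F\<^sub>1 * (transpose_mat F\<^sub>1 * Y) = C * Y"
    unfolding C_def by (rule assoc_mult_mat[OF F1 F1T Y, symmetric])
  also have "X * (C * Y) = X * C * Y" by (rule assoc_mult_mat[OF X C Y, symmetric])
  also have "X * C = transpose_mat F\<^sub>1"
  proof -
    have "X * C = transpose_mat (C * G * F\<^sub>1)"
      unfolding X_def transpose_mult[OF CG F1] transpose_mult[OF C G] GT sym
      by (rule assoc_mult_mat[OF F1T G C])
    then show ?thesis by (simp only: CGF1)
  qed
  finally have "W * transpose_mat W * W = W" by (simp only: W_Y[symmetric])
  then have KK: "K * K = K"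
    using W by (simp add: K_def assoc_mult_mat[of _ k\<^sub>2 k\<^sub>1 _ k\<^sub>2 _ k\<^sub>2] assoc_mult_mat[of _ k\<^sub>1 k\<^sub>2 _ k\<^sub>1 _ k\<^sub>2])
  have "(W *\<^sub>v x) \<bullet> (W *\<^sub>v x) \<le> x \<bullet> x" if x: "x \<in> carrier_vec k\<^sub>2" for x
  proof -
    have Kx: "K *\<^sub>v x \<in> carrier_vec k\<^sub>2" using K x by simp
    have 1: "(W *\<^sub>v x) \<bullet> (W *\<^sub>v x) = x \<bullet> (K *\<^sub>v x)"
      using transpose_vec_mult_scalar[of W k\<^sub>1 k\<^sub>2 x "W *\<^sub>v x"] W x Kx
      by (simp add: K_def assoc_mult_mat_vec[of _ k\<^sub>2 k\<^sub>1 _ k\<^sub>2] comm_scalar_prod[of x k\<^sub>2])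
    have 2: "(K *\<^sub>v x) \<bullet> (K *\<^sub>v x) = x \<bullet> (K *\<^sub>v x)"
      using transpose_vec_mult_scalar[OF K Kx x] K x assoc_mult_mat_vec[OF K K x] by (simp add: KT KK)
    \<comment> \<open>For a symmetric idempotent \<open>K\<close> this square expands to
      \<open>x \<bullet> x - x \<bullet> (K *\<^sub>v x)\<close>.\<close>
    have "0 \<le> (x - K *\<^sub>v x) \<bullet> (x - K *\<^sub>v x)" by (simp add: scalar_prod_def sum_nonneg)
    also have "\<dots> = x \<bullet> x - x \<bullet> (K *\<^sub>v x) - ((K *\<^sub>v x) \<bullet> x - (K *\<^sub>v x) \<bullet> (K *\<^sub>v x))"
      using x Kx by (simp add: minus_scalar_prod_distrib[of _ k\<^sub>2] scalar_prod_minus_distrib[of _ k\<^sub>2])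
    finally show ?thesis using 1 2 comm_scalar_prod[OF x Kx] by simp
  qed
  then show thesis using that W FW by blast
qed

subsection \<open>The factorization bound\<close>

text \<open>The hypotheses are symmetric in the two factors, so this one inequality suffices. The
  bounds on \<open>s\<close> guarantee that both sums run over \<open>s\<close> actual eigenvalues,
  even when the two widths differ.\<close>

lemma z_DFact_le:
  fixes C A F\<^sub>1 F\<^sub>2 :: "real mat"
  assumes s: "0 < s" "s \<le> k\<^sub>1" "s \<le> k\<^sub>2"
    and F1: "F\<^sub>1 \<in> carrier_mat n k\<^sub>1" and C1: "C = F\<^sub>1 * transpose_mat F\<^sub>1"
    and F2: "F\<^sub>2 \<in> carrier_mat n k\<^sub>2" and C2: "C = F\<^sub>2 * transpose_mat F\<^sub>2"
  shows "z_DFact C s A b F\<^sub>2 \<le> z_DFact C s A b F\<^sub>1"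
proof -
  obtain W where W: "W \<in> carrier_mat k\<^sub>1 k\<^sub>2" and FW: "F\<^sub>2 * transpose_mat W = F\<^sub>1"
    and contr: "\<And>x. x \<in> carrier_vec k\<^sub>2 \<Longrightarrow> (W *\<^sub>v x) \<bullet> (W *\<^sub>v x) \<le> x \<bullet> x"
    using douglas_contraction[OF F1 F2] C1 C2 by metis
  have WF: "W * transpose_mat F\<^sub>2 = transpose_mat F\<^sub>1"
    using F2 W unfolding FW[symmetric] by (simp add: transpose_mult[of _ n k\<^sub>2 _ k\<^sub>1])
  have "\<exists>\<Theta>'. dfact_feasible C A F\<^sub>2 \<Theta>' \<upsilon> \<nu> \<pi> \<tau> \<and>
      dfact_objective C s b F\<^sub>2 \<Theta>' \<nu> \<pi> \<tau> \<le> dfact_objective C s b F\<^sub>1 \<Theta> \<nu> \<pi> \<tau>"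
    if feas: "dfact_feasible C A F\<^sub>1 \<Theta> \<upsilon> \<nu> \<pi> \<tau>" for \<Theta> \<upsilon> \<nu> \<pi> \<tau>
  proof -
    have T: "\<Theta> \<in> carrier_mat k\<^sub>1 k\<^sub>1" and pd: "pd_mat \<Theta>"
      using feas F1 by (auto simp: dfact_feasible_def Let_def)
    have sym: "symmetric_mat \<Theta>" using pd by (simp add: pd_mat_def)
    define es where "es = sorted_list_of_multiset (proots (char_poly \<Theta>))"
    \<comment> \<open>With 0-based indexing this is the \<open>s\<close>-th smallest eigenvalue, the
      largest of those entering the objective.\<close>
    define t where "t = es ! (s - 1)"
    have len: "length es = k\<^sub>1" using spectral_decomposition[OF T sym es_def] by metis
    have t: "0 < t" using eigenvalues_pos[OF T pd es_def, of "s - 1"] s by (simp add: t_def)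
    define K where "K = transpose_mat W * W"
    define R where "R = transpose_mat W * \<Theta> * W"
    define \<Theta>' where "\<Theta>' = R + t \<cdot>\<^sub>m (1\<^sub>m k\<^sub>2 - K)"
    have K: "K \<in> carrier_mat k\<^sub>2 k\<^sub>2" and R: "R \<in> carrier_mat k\<^sub>2 k\<^sub>2"
      using W T by (simp_all add: K_def R_def)
    have S: "t \<cdot>\<^sub>m (1\<^sub>m k\<^sub>2 - K) \<in> carrier_mat k\<^sub>2 k\<^sub>2" using K by (simp add: minus_carrier_mat)
    have T': "\<Theta>' \<in> carrier_mat k\<^sub>2 k\<^sub>2" using R S by (simp add: \<Theta>'_def)
    have KT: "transpose_mat K = K" using W by (simp add: K_def transpose_mult[of _ k\<^sub>2 k\<^sub>1 _ k\<^sub>2])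
    have RT: "transpose_mat R = R"
      using W T sym unfolding R_def symmetric_mat_def
      by (simp add: transpose_mult[of _ k\<^sub>2 k\<^sub>1 _ k\<^sub>2] transpose_mult[of _ k\<^sub>2 k\<^sub>1 _ k\<^sub>1]
          transpose_mult[of _ k\<^sub>1 k\<^sub>1 _ k\<^sub>2] assoc_mult_mat[of _ k\<^sub>2 k\<^sub>1 _ k\<^sub>1 _ k\<^sub>2])
    have sym': "symmetric_mat \<Theta>'"
      unfolding symmetric_mat_def
    proof (rule eq_matI)
      fix i j assume "i < dim_row \<Theta>'" "j < dim_col \<Theta>'"
      then show "transpose_mat \<Theta>' $$ (i, j) = \<Theta>' $$ (i, j)"
        using T' R K arg_cong[OF KT, of "\<lambda>M. M $$ (i, j)"] arg_cong[OF RT, of "\<lambda>M. M $$ (i, j)"]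
        by (auto simp: \<Theta>'_def)
    qed (use T' in auto)
    have form: "x \<bullet> (\<Theta>' *\<^sub>v x)
        = (W *\<^sub>v x) \<bullet> (\<Theta> *\<^sub>v (W *\<^sub>v x)) + t * (x \<bullet> x - (W *\<^sub>v x) \<bullet> (W *\<^sub>v x))"
      if x: "x \<in> carrier_vec k\<^sub>2" for x
    proof -
      have Wx: "W *\<^sub>v x \<in> carrier_vec k\<^sub>1" and TWx: "\<Theta> *\<^sub>v (W *\<^sub>v x) \<in> carrier_vec k\<^sub>1"
        and Rx: "R *\<^sub>v x \<in> carrier_vec k\<^sub>2" and Kx: "K *\<^sub>v x \<in> carrier_vec k\<^sub>2"
        using W T x R K by simp_all
      have adj: "x \<bullet> (transpose_mat W *\<^sub>v y) = (W *\<^sub>v x) \<bullet> y" if "y \<in> carrier_vec k\<^sub>1" for y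
        using transpose_vec_mult_scalar[of "transpose_mat W" k\<^sub>2 k\<^sub>1 y x] that W x by simp
      have "\<Theta>' *\<^sub>v x = R *\<^sub>v x + t \<cdot>\<^sub>v (x - K *\<^sub>v x)"
      proof -
        have "\<Theta>' *\<^sub>v x = R *\<^sub>v x + (t \<cdot>\<^sub>m (1\<^sub>m k\<^sub>2 - K)) *\<^sub>v x"
          unfolding \<Theta>'_def by (rule add_mult_distrib_mat_vec[OF R S x])
        also have "(t \<cdot>\<^sub>m (1\<^sub>m k\<^sub>2 - K)) *\<^sub>v x = t \<cdot>\<^sub>v ((1\<^sub>m k\<^sub>2 - K) *\<^sub>v x)"
          using K x by (intro eq_vecI) auto
        also have "(1\<^sub>m k\<^sub>2 - K) *\<^sub>v x = x - K *\<^sub>v x"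
          using minus_mult_distrib_mat_vec[OF one_carrier_mat K x] x by simp
        finally show ?thesis .
      qed
      then have "x \<bullet> (\<Theta>' *\<^sub>v x) = x \<bullet> (R *\<^sub>v x) + t * (x \<bullet> x - x \<bullet> (K *\<^sub>v x))"
        using x Rx Kx by (simp add: scalar_prod_add_distrib[of _ k\<^sub>2] scalar_prod_minus_distrib[of _ k\<^sub>2])
      moreover have "x \<bullet> (R *\<^sub>v x) = (W *\<^sub>v x) \<bullet> (\<Theta> *\<^sub>v (W *\<^sub>v x))"
        using adj[OF TWx] W T x unfolding R_def
        by (simp add: assoc_mult_mat_vec[of _ k\<^sub>2 k\<^sub>1 _ k\<^sub>2] assoc_mult_mat_vec[of _ k\<^sub>2 k\<^sub>1 _ k\<^sub>1])
      moreover have "x \<bullet> (K *\<^sub>v x) = (W *\<^sub>v x) \<bullet> (W *\<^sub>v x)"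
        using adj[OF Wx] W x unfolding K_def by (simp add: assoc_mult_mat_vec[of _ k\<^sub>2 k\<^sub>1 _ k\<^sub>2])
      ultimately show ?thesis by simp
    qed
    have pd': "pd_mat \<Theta>'"
      unfolding pd_mat_def
    proof (intro conjI ballI impI sym')
      fix x :: "real vec" assume "x \<in> carrier_vec (dim_row \<Theta>')" and "x \<noteq> 0\<^sub>v (dim_row \<Theta>')"
      then have x: "x \<in> carrier_vec k\<^sub>2" and x0: "x \<noteq> 0\<^sub>v k\<^sub>2" using T' by auto
      have Wx: "W *\<^sub>v x \<in> carrier_vec k\<^sub>1" using W x by simp
      show "0 < x \<bullet> (\<Theta>' *\<^sub>v x)"
      \<comment> \<open>On the kernel of \<open>W\<close> positivity comes from the summand with
        factor \<open>t\<close>, elsewhere from \<open>\<Theta>\<close>.\<close>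
      proof (cases "W *\<^sub>v x = 0\<^sub>v k\<^sub>1")
        case True
        have "\<Theta> *\<^sub>v 0\<^sub>v k\<^sub>1 \<in> carrier_vec k\<^sub>1" using T by simp
        moreover have "0 < x \<bullet> x" using conjugate_square_greater_0_vec[OF x] x0
          by (simp add: conjugate_vec_def vec_eq_iff)
        ultimately show ?thesis using t by (simp add: form[OF x] True)
      next
        case False
        then have "0 < (W *\<^sub>v x) \<bullet> (\<Theta> *\<^sub>v (W *\<^sub>v x))" using pd T Wx by (auto simp: pd_mat_def)
        moreover have "0 \<le> t * (x \<bullet> x - (W *\<^sub>v x) \<bullet> (W *\<^sub>v x))" using t contr[OF x] by simp
        ultimately show ?thesis by (simp add: form[OF x])
      qed
    qed
    \<comment> \<open>The equality constraint sees the matrix variable only through this product, so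
      the other variables can stay as they are.\<close>
    have FTF: "F\<^sub>2 * \<Theta>' * transpose_mat F\<^sub>2 = F\<^sub>1 * \<Theta> * transpose_mat F\<^sub>1"
    proof -
      have RF: "R * transpose_mat F\<^sub>2 = transpose_mat W * (\<Theta> * transpose_mat F\<^sub>1)"
        using W T F2 unfolding R_def WF[symmetric]
        by (simp add: assoc_mult_mat[of _ k\<^sub>2 k\<^sub>1 _ k\<^sub>2 _ n] assoc_mult_mat[of _ k\<^sub>2 k\<^sub>1 _ k\<^sub>1 _ n])
      have KF: "K * transpose_mat F\<^sub>2 = transpose_mat W * transpose_mat F\<^sub>1"
        using W F2 unfolding K_def WF[symmetric]
        by (simp add: assoc_mult_mat[of _ k\<^sub>2 k\<^sub>1 _ k\<^sub>2 _ n])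
      have FWX: "F\<^sub>2 * (transpose_mat W * X) = F\<^sub>1 * X" if "X \<in> carrier_mat k\<^sub>1 n" for X
        using that W F2 assoc_mult_mat[of F\<^sub>2 n k\<^sub>2 "transpose_mat W" k\<^sub>1 X n] by (simp add: FW)
      have F2T: "transpose_mat F\<^sub>2 \<in> carrier_mat k\<^sub>2 n" using F2 by simp
      have "\<Theta>' * transpose_mat F\<^sub>2 = R * transpose_mat F\<^sub>2 + t \<cdot>\<^sub>m (transpose_mat F\<^sub>2 - K * transpose_mat F\<^sub>2)"
        using F2T K S add_mult_distrib_mat[OF R S F2T] minus_mult_distrib_mat[OF one_carrier_mat K F2T]
        by (simp add: \<Theta>'_def mult_smult_assoc_mat[of _ k\<^sub>2 k\<^sub>2 _ n] minus_carrier_mat)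
      then have "F\<^sub>2 * (\<Theta>' * transpose_mat F\<^sub>2) = F\<^sub>2 * (R * transpose_mat F\<^sub>2)
          + t \<cdot>\<^sub>m (F\<^sub>2 * transpose_mat F\<^sub>2 - F\<^sub>2 * (K * transpose_mat F\<^sub>2))"
        using F2 F2T R K
        by (simp add: mult_add_distrib_mat[of _ n k\<^sub>2 _ n] mult_smult_distrib[of _ n k\<^sub>2 _ n]
            mult_minus_distrib_mat[of _ n k\<^sub>2 _ n] minus_carrier_mat)
      also have "\<dots> = F\<^sub>1 * (\<Theta> * transpose_mat F\<^sub>1) + t \<cdot>\<^sub>m (C - C)"
        using F1 T by (simp add: RF KF FWX flip: C1 C2)
      also have "\<dots> = F\<^sub>1 * (\<Theta> * transpose_mat F\<^sub>1)"
        using F1 T C1 by (intro eq_matI) auto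
      finally show ?thesis
        using F1 F2 T T' by (simp add: assoc_mult_mat[of _ n k\<^sub>2 _ k\<^sub>2 _ n] assoc_mult_mat[of _ n k\<^sub>1 _ k\<^sub>1 _ n])
    qed
    have "dfact_feasible C A F\<^sub>2 \<Theta>' \<upsilon> \<nu> \<pi> \<tau>"
      using feas F1 F2 T' pd' unfolding dfact_feasible_def Let_def FTF by auto
    moreover have "(\<Sum>l = k\<^sub>1 - s + 1..k\<^sub>1. ln (eigval_desc \<Theta> l)) \<le> (\<Sum>l = k\<^sub>2 - s + 1..k\<^sub>2. ln (eigval_desc \<Theta>' l))"
      unfolding sum_eigval_desc[OF T sym s(2)] sum_eigval_desc[OF T' sym' s(3)]
    proof (rule sum_mono)
      fix j assume "j \<in> {..<s}"
      then have j: "j < k\<^sub>2" "j < k\<^sub>1" "j \<le> s - 1" using s by auto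
      have "es ! j \<le> t"
        using sorted_nth_mono[of es j "s - 1"] j s len by (simp add: t_def es_def)
      then have "es ! j \<le> sorted_list_of_multiset (proots (char_poly \<Theta>')) ! j"
        using eigenvalue_comparison[OF T' sym' T sym W refl es_def contr _ j(1,2), of t] form by simp
      \<comment> \<open>Positivity is what allows the comparison to pass through
        \<open>ln\<close>.\<close>
      moreover have "0 < es ! j" using eigenvalues_pos[OF T pd es_def j(2)] .
      ultimately show "ln (sorted_list_of_multiset (proots (char_poly \<Theta>)) ! j)
          \<le> ln (sorted_list_of_multiset (proots (char_poly \<Theta>')) ! j)"
        by (simp add: es_def)
    qed
    then have "dfact_objective C s b F\<^sub>2 \<Theta>' \<nu> \<pi> \<tau> \<le> dfact_objective C s b F\<^sub>1 \<Theta> \<nu> \<pi> \<tau>"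
      using F1 F2 by (simp add: dfact_objective_def Let_def)
    ultimately show ?thesis by blast
  qed
  \<comment> \<open>Each value attained for \<open>F\<^sub>1\<close> has one at most as large for
    \<open>F\<^sub>2\<close>. This also covers an infeasible problem for \<open>F\<^sub>1\<close>,
    whose infimum is infinite.\<close>
  then show ?thesis
    unfolding z_DFact_def by (intro Inf_mono) fastforce
qed

theorem corollary2p3:
  fixes n m s r k\<^sub>1 k\<^sub>2 :: nat
    and C A F\<^sub>1 F\<^sub>2 :: "real mat" and b :: "real vec"
  assumes "1 < n" and "0 < s" and "s < n"
    and "C \<in> carrier_mat n n" and "psd_mat C"
    and "r = vec_space.rank n C" and "s \<le> r"
    and "A \<in> carrier_mat m n" and "b \<in> carrier_vec m"
    and "r \<le> k\<^sub>1" and "k\<^sub>1 \<le> n" and "F\<^sub>1 \<in> carrier_mat n k\<^sub>1" and "C = F\<^sub>1 * transpose_mat F\<^sub>1"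
    and "r \<le> k\<^sub>2" and "k\<^sub>2 \<le> n" and "F\<^sub>2 \<in> carrier_mat n k\<^sub>2" and "C = F\<^sub>2 * transpose_mat F\<^sub>2"
  shows "z_DFact C s A b F\<^sub>1 = z_DFact C s A b F\<^sub>2"
proof (rule antisym)
  \<comment> \<open>The rank \<open>r\<close> lies between \<open>s\<close> and both widths.\<close>
  have s: "s \<le> k\<^sub>1" "s \<le> k\<^sub>2" using assms(7,10,14) by auto
  show "z_DFact C s A b F\<^sub>1 \<le> z_DFact C s A b F\<^sub>2"
    by (rule z_DFact_le[OF assms(2) s(2,1) assms(16,17,12,13)])
  show "z_DFact C s A b F\<^sub>2 \<le> z_DFact C s A b F\<^sub>1"
    by (rule z_DFact_le[OF assms(2) s assms(12,13,16,17)])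
qed

end
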